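(* Let $\mathbb{B}=\{\mathbf{v}\in\mathbb{R}^n : \|\mathbf{v}\|<1\}$ be the open unit ball in $n$-dimensional Euclidean space, where $\|\cdot\|$ is the Euclidean norm, and let $\oplus_E$ be Einstein addition on $\mathbb{B}$. Then the function $\|\cdot\|_E\colon\mathbb{B}\to\mathbb{R}$ defined by $$\|\mathbf{v}\|_E=\tanh^{-1}\|\mathbf{v}\|,\qquad \mathbf{v}\in\mathbb{B},$$ is a gyronorm on the Einstein gyrogroup $(\mathbb{B},\oplus_E)$.
   Context: A gyrogroup is a nonempty set $G$ with a binary operation $\oplus$ such that: (G1) there is an element $e\in G$ with $e\oplus a=a$ for all $a\in G$; (G2) for each $a\in G$ there is $b\in G$ with $b\oplus a=e$; (G3) for all $a,b\in G$ there is an automorphism $\mathrm{gyr}[a,b]$ of $(G,\oplus)$ (a bijection $G\to G$ preserving $\oplus$) such that $a\oplus(b\oplus c)=(a\oplus b)\oplus\mathrm{gyr}[a,b]c$ for all $c\in G$; (G4) $\mathrm{gyr}[a\oplus b,b]=\mathrm{gyr}[a,b]$ for all $a,b\in G$. Then $e$ is the unique two-sided identity and each $a$ has a unique two-sided inverse $\ominus a$; $\mathrm{gyr}[a,b]$ is called the gyroautomorphism generated by $a$ and $b$. A gyronorm on a gyrogroup $G$ is a function $\|\cdot\|\colon G\to\mathbb{R}$ such that: (1) $\|x\|\ge 0$ for all $x\in G$, and $\|x\|=0$ if and only if $x=e$; (2) $\|\ominus x\|=\|x\|$ for all $x\in G$; (3) $\|x\oplus y\|\le\|x\|+\|y\|$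 for all $x,y\in G$; (4) $\|\mathrm{gyr}[a,b]x\|=\|x\|$ for all $a,b,x\in G$. Einstein addition on $\mathbb{B}$ is defined by $$\mathbf{u}\oplus_E\mathbf{v}=\frac{1}{1+\langle\mathbf{u},\mathbf{v}\rangle}\left(\mathbf{u}+\frac{1}{\gamma_{\mathbf{u}}}\mathbf{v}+\frac{\gamma_{\mathbf{u}}}{1+\gamma_{\mathbf{u}}}\langle\mathbf{u},\mathbf{v}\rangle\mathbf{u}\right),\qquad \gamma_{\mathbf{u}}=\frac{1}{\sqrt{1-\|\mathbf{u}\|^2}},$$ where $\langle\cdot,\cdot\rangle$ is the Euclidean inner product. It is known that $(\mathbb{B},\oplus_E)$ is a gyrogroup, called the Einstein gyrogroup; its identity is $\mathbf{0}$, and the inverse of $\mathbf{v}$ is $-\mathbf{v}$. Here $\tanh^{-1}$ is the inverse of the hyperbolic tangent function on $\mathbb{R}$. *)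

theory Defs
  imports "HOL-Analysis.Analysis" "HOL-Algebra.Bij"
begin

text \<open>
  Gyrogroups are magmas with a distinguished element, represented by the record type of
  \<^theory>\<open>HOL-Algebra.Group\<close>, so the gyrogroup operation is written \<open>\<otimes>\<close>, its identity \<open>\<one>\<close>
  and inverses \<open>inv x\<close>. The elements of \<open>auto G\<close> are extensional, i.e. undefined outside
  \<open>carrier G\<close>; hence the automorphism in the third gyrogroup axiom is unique as a
  HOL function (lemma \<open>gyr_ex1\<close> below), and \<open>gyr\<close> denotes it.
\<close>

definition gyr :: "('a, 'b) monoid_scheme \<Rightarrow> 'a \<Rightarrow> 'a \<Rightarrow> 'a \<Rightarrow> 'a" where
  "gyr G a b = (THE \<phi>. \<phi> \<in> auto G \<and>
     (\<forall>c\<in>carrier G. a \<otimes>\<^bsub>G\<^esub> (b \<otimes>\<^bsub>G\<^esub> c) = (a \<otimes>\<^bsub>G\<^esub> b) \<otimes>\<^bsub>G\<^esub> \<phi> c))"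

locale gyrogroup =
  fixes G (structure)
  assumes m_closed [intro, simp]:
      "\<lbrakk>a \<in> carrier G; b \<in> carrier G\<rbrakk> \<Longrightarrow> a \<otimes> b \<in> carrier G"
    and one_closed [intro, simp]: "\<one> \<in> carrier G"
    and l_one [simp]: "a \<in> carrier G \<Longrightarrow> \<one> \<otimes> a = a"
    and l_inv_ex: "a \<in> carrier G \<Longrightarrow> \<exists>b\<in>carrier G. b \<otimes> a = \<one>"
    and gyr_ex: "\<lbrakk>a \<in> carrier G; b \<in> carrier G\<rbrakk> \<Longrightarrow>
      \<exists>\<phi>\<in>auto G. \<forall>c\<in>carrier G. a \<otimes> (b \<otimes> c) = (a \<otimes> b) \<otimes> \<phi> c"
    and gyr_loop: "\<lbrakk>a \<in> carrier G; b \<in> carrier G\<rbrakk> \<Longrightarrow> gyr G (a \<otimes> b) b = gyr G a b"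
begin

lemma l_cancel:
  assumes "a \<in> carrier G" "x \<in> carrier G" "y \<in> carrier G" "a \<otimes> x = a \<otimes> y"
  shows "x = y"
proof -
  obtain b where b: "b \<in> carrier G" "b \<otimes> a = \<one>"
    using l_inv_ex assms(1) by blast
  obtain \<phi> where \<phi>: "\<phi> \<in> auto G"
    "\<And>c. c \<in> carrier G \<Longrightarrow> b \<otimes> (a \<otimes> c) = (b \<otimes> a) \<otimes> \<phi> c"
    using gyr_ex[OF b(1) assms(1)] by blast
  have bij: "bij_betw \<phi> (carrier G) (carrier G)"
    using \<phi>(1) by (simp add: auto_def Bij_def)
  have "\<phi> x = \<phi> y"
    using \<phi>(2)[of x] \<phi>(2)[of y] assms b(2) bij by (simp add: bij_betw_apply)
  then show ?thesis
    using bij assms(2,3) by (meson bij_betw_def inj_onD)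
qed

lemma gyr_ex1:
  assumes a: "a \<in> carrier G" and b: "b \<in> carrier G"
  shows "\<exists>!\<phi>. \<phi> \<in> auto G \<and> (\<forall>c\<in>carrier G. a \<otimes> (b \<otimes> c) = (a \<otimes> b) \<otimes> \<phi> c)"
proof (rule ex_ex1I)
  show "\<exists>\<phi>. \<phi> \<in> auto G \<and> (\<forall>c\<in>carrier G. a \<otimes> (b \<otimes> c) = (a \<otimes> b) \<otimes> \<phi> c)"
    using gyr_ex[OF a b] by blast
next
  fix \<phi> \<psi>
  assume \<phi>: "\<phi> \<in> auto G \<and> (\<forall>c\<in>carrier G. a \<otimes> (b \<otimes> c) = (a \<otimes> b) \<otimes> \<phi> c)"
    and \<psi>: "\<psi> \<in> auto G \<and> (\<forall>c\<in>carrier G. a \<otimes> (b \<otimes> c) = (a \<otimes> b) \<otimes> \<psi> c)"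
  show "\<phi> = \<psi>"
  proof (rule extensionalityI[of _ "carrier G"])
    fix c assume c: "c \<in> carrier G"
    have "\<phi> c \<in> carrier G" "\<psi> c \<in> carrier G"
      using \<phi> \<psi> c by (auto simp: auto_def Bij_def bij_betw_apply)
    moreover have "(a \<otimes> b) \<otimes> \<phi> c = (a \<otimes> b) \<otimes> \<psi> c"
      using \<phi> \<psi> c by metis
    ultimately show "\<phi> c = \<psi> c"
      using l_cancel[of "a \<otimes> b"] a b by blast
  qed (use \<phi> \<psi> in \<open>auto simp: auto_def Bij_def\<close>)
qed

lemma gyr_auto: "\<lbrakk>a \<in> carrier G; b \<in> carrier G\<rbrakk> \<Longrightarrow> gyr G a b \<in> auto G"
  and gyr_assoc: "\<lbrakk>a \<in> carrier G; b \<in> carrier G; c \<in> carrier G\<rbrakk> \<Longrightarrow>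
    a \<otimes> (b \<otimes> c) = (a \<otimes> b) \<otimes> gyr G a b c"
  using theI'[OF gyr_ex1, of a b] unfolding gyr_def by blast+

lemma gyr_closed:
  "\<lbrakk>a \<in> carrier G; b \<in> carrier G; c \<in> carrier G\<rbrakk> \<Longrightarrow> gyr G a b c \<in> carrier G"
  using gyr_auto[of a b] by (auto simp: auto_def Bij_def bij_betw_apply)

lemma l_inv_imp_l_assoc:
  assumes a: "a \<in> carrier G" and b: "b \<in> carrier G" and c: "c \<in> carrier G"
    and ba: "b \<otimes> a = \<one>"
  shows "b \<otimes> (a \<otimes> c) = c"
proof -
  have "a \<otimes> c = a \<otimes> gyr G \<one> a c"
    using gyr_assoc[of \<one> a c] a c by simp
  then have "gyr G \<one> a c = c"
    using l_cancel[of a c "gyr G \<one> a c"] a c gyr_closed[of \<one> a c] by auto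
  moreover have "gyr G b a = gyr G \<one> a"
    using gyr_loop[OF b a] ba by simp
  ultimately show ?thesis
    using gyr_assoc[OF b a c] ba c by simp
qed

lemma r_one [simp]:
  assumes a: "a \<in> carrier G"
  shows "a \<otimes> \<one> = a"
proof -
  obtain b where b: "b \<in> carrier G" "b \<otimes> a = \<one>"
    using l_inv_ex a by blast
  have "b \<otimes> (a \<otimes> \<one>) = b \<otimes> a"
    using l_inv_imp_l_assoc[OF a b(1) one_closed b(2)] b(2) by simp
  then show ?thesis
    using l_cancel[OF b(1)] a by blast
qed

lemma l_inv_imp_r_inv:
  assumes a: "a \<in> carrier G" and b: "b \<in> carrier G" and ba: "b \<otimes> a = \<one>"
  shows "a \<otimes> b = \<one>"
proof -
  have "b \<otimes> (a \<otimes> b) = b \<otimes> \<one>"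
    using l_inv_imp_l_assoc[OF a b b ba] b by simp
  then show ?thesis
    using l_cancel[OF b] a b by blast
qed

text \<open>The next two lemmas show that \<open>inv\<close> of \<^theory>\<open>HOL-Algebra.Group\<close> is the two-sided
  inverse in any gyrogroup.\<close>

lemma inv_equality:
  assumes a: "a \<in> carrier G" and b: "b \<in> carrier G" and ba: "b \<otimes> a = \<one>"
  shows "inv a = b"
  unfolding m_inv_def
proof (rule the_equality)
  show "b \<in> carrier G \<and> a \<otimes> b = \<one> \<and> b \<otimes> a = \<one>"
    using assms l_inv_imp_r_inv by blast
  show "y = b" if "y \<in> carrier G \<and> a \<otimes> y = \<one> \<and> y \<otimes> a = \<one>" for y
    using that l_cancel[OF a, of y b] b l_inv_imp_r_inv[OF a b ba] by simp
qed

lemma inv_two_sided: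
  assumes a: "a \<in> carrier G"
  shows "inv a \<in> carrier G" "inv a \<otimes> a = \<one>" "a \<otimes> inv a = \<one>"
  using l_inv_ex[OF a] inv_equality[OF a] l_inv_imp_r_inv[OF a] by auto

end

locale gyronorm = gyrogroup G for G (structure) +
  fixes N :: "'a \<Rightarrow> real"
  assumes gyronorm_nonneg: "x \<in> carrier G \<Longrightarrow> N x \<ge> 0"
    and gyronorm_eq_zero_iff: "x \<in> carrier G \<Longrightarrow> N x = 0 \<longleftrightarrow> x = \<one>"
    and gyronorm_inv: "x \<in> carrier G \<Longrightarrow> N (inv x) = N x"
    and gyronorm_triangle:
      "\<lbrakk>x \<in> carrier G; y \<in> carrier G\<rbrakk> \<Longrightarrow> N (x \<otimes> y) \<le> N x + N y"
    and gyronorm_gyr: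
      "\<lbrakk>a \<in> carrier G; b \<in> carrier G; x \<in> carrier G\<rbrakk> \<Longrightarrow> N (gyr G a b x) = N x"

definition lorentz_factor :: "'a::real_inner \<Rightarrow> real" where
  "lorentz_factor u = 1 / sqrt (1 - (norm u)\<^sup>2)"

definition einstein_add :: "'a::real_inner \<Rightarrow> 'a \<Rightarrow> 'a" where
  "einstein_add u v = (1 / (1 + u \<bullet> v)) *\<^sub>R
     (u + (1 / lorentz_factor u) *\<^sub>R v
        + (lorentz_factor u / (1 + lorentz_factor u) * (u \<bullet> v)) *\<^sub>R u)"

definition einstein_gyrogroup :: "'a::real_inner monoid" where
  "einstein_gyrogroup = \<lparr>carrier = {v. norm v < 1}, mult = einstein_add, one = 0\<rparr>"

end

(*
  The ball is the Klein model of the hyperboloid q = 1, t > 0 in Minkowski space, where v corresponds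
  to the point gamma_v (1, v) and Einstein addition by u becomes the Lorentz boost L_u taking the base
  point e to gamma_u (1, u).  A boost is a product of two point reflections, one of them at e; this
  gives L_{-u} L_u = id and the Bol identity L_u L_v L_u = L_{u + (v + u)},
  with + for Einstein addition.  The map
  L_{-(a + b)} L_a L_b fixes e and preserves q, hence commutes with the addition and preserves the norm,
  and it induces gyr[a,b]; the loop property follows from the Bol identity.  Finally
  gamma_v = cosh (artanh |v|), and gamma_{u + v} = gamma_u gamma_v (1 + <u,v>) together with
  Cauchy-Schwarz and the addition theorem for cosh gives the triangle inequality.
*)
theory Submission
  imports Defs
begin

section \<open>Minkowski space: hyperboloid, point reflections and boosts\<close>

definition minkowski :: "real \<times> 'a \<Rightarrow> real \<times> 'a::real_inner \<Rightarrow> real" where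
  "minkowski y z = fst y * fst z - snd y \<bullet> snd z"

definition time_axis :: "real \<times> 'a::real_inner" where
  "time_axis = (1, 0)"

definition hyperboloid :: "(real \<times> 'a::real_inner) set" where
  "hyperboloid = {p. minkowski p p = 1 \<and> fst p > 0}"

definition lorentz_map :: "(real \<times> 'a::real_inner \<Rightarrow> real \<times> 'a) \<Rightarrow> bool" where
  "lorentz_map f \<longleftrightarrow> linear f \<and> (\<forall>y z. minkowski (f y) (f z) = minkowski y z)"

text \<open>For \<open>minkowski n n = 1\<close> this fixes \<open>n\<close> and negates its
  Minkowski-orthogonal complement.\<close>

definition point_refl :: "real \<times> 'a \<Rightarrow> real \<times> 'a \<Rightarrow> real \<times> 'a::real_inner" where
  "point_refl n y = (2 * minkowski n y) *\<^sub>R n - y"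

text \<open>The formula uses only \<open>p\<close>, \<open>time_axis\<close> and the form, which
  gives \<open>boost_conj\<close> directly and avoids square roots.\<close>

definition boost :: "real \<times> 'a \<Rightarrow> real \<times> 'a \<Rightarrow> real \<times> 'a::real_inner" where
  "boost p y = y + (2 * minkowski time_axis y) *\<^sub>R p
     - (minkowski (time_axis + p) y / (1 + minkowski time_axis p)) *\<^sub>R (time_axis + p)"

lemma minkowski_simps:
  "minkowski (x + y) z = minkowski x z + minkowski y z"
  "minkowski z (x + y) = minkowski z x + minkowski z y"
  "minkowski (x - y) z = minkowski x z - minkowski y z"
  "minkowski z (x - y) = minkowski z x - minkowski z y"
  "minkowski (c *\<^sub>R x) z = c * minkowski x z"
  "minkowski z (c *\<^sub>R x) = c * minkowski z x"
  by (simp_all add: minkowski_def inner_simps algebra_simps)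

lemma minkowski_commute: "minkowski y z = minkowski z y"
  by (simp add: minkowski_def inner_commute mult.commute)

lemma minkowski_self: "minkowski p p = (fst p)\<^sup>2 - (norm (snd p))\<^sup>2"
  by (simp add: minkowski_def power2_norm_eq_inner) (simp add: power2_eq_square)

lemma time_axis_simps [simp]: "fst time_axis = 1" "snd time_axis = 0"
  by (simp_all add: time_axis_def)

lemma minkowski_time_axis [simp]: "minkowski time_axis y = fst y" "minkowski y time_axis = fst y"
  by (simp_all add: minkowski_def)

lemma hyperboloidD:
  assumes "p \<in> hyperboloid"
  shows "minkowski p p = 1" "fst p > 0" "norm (snd p) < fst p"
proof -
  show "minkowski p p = 1" and pos: "fst p > 0"
    using assms by (auto simp: hyperboloid_def)
  then have "(norm (snd p))\<^sup>2 < (fst p)\<^sup>2"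
    by (simp add: minkowski_self)
  then show "norm (snd p) < fst p"
    using pos by (simp add: power2_less_imp_less)
qed

text \<open>Keeps boosts on the sheet \<open>fst p > 0\<close> and, read on the ball, makes
  \<open>1 + u \<bullet> v\<close> nonzero.\<close>

lemma abs_inner_snd_less:
  assumes "p \<in> hyperboloid" "y \<in> hyperboloid"
  shows "\<bar>snd p \<bullet> snd y\<bar> < fst p * fst y"
proof -
  have "\<bar>snd p \<bullet> snd y\<bar> \<le> norm (snd p) * norm (snd y)"
    by (rule Cauchy_Schwarz_ineq2)
  also have "\<dots> < fst p * fst y"
    using hyperboloidD[OF assms(1)] hyperboloidD[OF assms(2)] by (intro mult_strict_mono) auto
  finally show ?thesis .
qed

section \<open>Lorentz maps and the factorization of boosts into point reflections\<close>

lemma lorentz_map_minkowski: "lorentz_map f \<Longrightarrow> minkowski (f y) (f z) = minkowski y z"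
  unfolding lorentz_map_def by blast

lemma lorentz_map_comp: "lorentz_map f \<Longrightarrow> lorentz_map g \<Longrightarrow> lorentz_map (\<lambda>x. f (g x))"
  using linear_compose[of g f] unfolding lorentz_map_def o_def by metis

lemma lorentz_map_point_refl:
  assumes "minkowski n n = 1"
  shows "lorentz_map (point_refl n)"
  unfolding lorentz_map_def
proof (intro conjI allI)
  show "linear (point_refl n)"
    by (rule linearI) (simp_all only: point_refl_def minkowski_simps algebra_simps scaleR_scaleR)
  show "minkowski (point_refl n y) (point_refl n z) = minkowski y z" for y z
    using assms minkowski_commute[of y n] by (simp add: point_refl_def minkowski_simps)
qed

lemma point_refl_conj:
  assumes "lorentz_map f"
  shows "f (point_refl n y) = point_refl (f n) (f y)"
  using assms lorentz_map_minkowski[OF assms, of n y]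
  by (simp add: lorentz_map_def point_refl_def linear_diff linear_scale)

text \<open>\<open>boost p y\<close> is a combination of \<open>p\<close>, \<open>y\<close> and
  \<open>time_axis\<close> with coefficients given by the form, and \<open>f\<close> respects all of
  this.\<close>

lemma boost_conj:
  assumes "lorentz_map f" "f time_axis = time_axis"
  shows "f (boost p y) = boost (f p) (f y)"
proof -
  have lin: "linear f"
    using assms(1) by (simp add: lorentz_map_def)
  have "minkowski time_axis y = minkowski time_axis (f y)" for y
    using lorentz_map_minkowski[OF assms(1), of time_axis y] assms(2) by simp
  moreover have "minkowski (time_axis + p) y = minkowski (time_axis + f p) (f y)"
    using lorentz_map_minkowski[OF assms(1), of "time_axis + p" y] assms(2) lin
    by (simp only: linear_add)
  ultimately show ?thesis
    using assms(2) lin unfolding boost_def by (simp only: linear_diff linear_add linear_scale)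
qed

lemma point_refl_invol: "minkowski n n = 1 \<Longrightarrow> point_refl n (point_refl n y) = y"
  by (simp add: point_refl_def minkowski_simps algebra_simps)

lemma point_refl_self: "minkowski n n = 1 \<Longrightarrow> point_refl n n = n"
  by (simp add: point_refl_def scaleR_2)

lemma point_refl_time_axis: "point_refl time_axis y = (fst y, - snd y)"
  by (simp add: point_refl_def prod_eq_iff)

text \<open>The base point and its reflection in \<open>n\<close> add up to a multiple of
  \<open>n\<close>, so the last term of the boost becomes the leading term of a reflection in
  \<open>n\<close>.\<close>

lemma boost_eq_point_refl:
  assumes "fst n \<noteq> 0"
  shows "point_refl n (point_refl time_axis y) = boost (point_refl n time_axis) y"
proof -
  have p: "time_axis + point_refl n time_axis = (2 * fst n) *\<^sub>R n"
    by (simp add: point_refl_def)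
  have "1 + minkowski time_axis (point_refl n time_axis) = fst ((2 * fst n) *\<^sub>R n)"
    unfolding p[symmetric] by simp
  then have "boost (point_refl n time_axis) y
      = y + (2 * fst y) *\<^sub>R point_refl n time_axis
        - (2 * fst n * minkowski n y / (2 * fst n * fst n)) *\<^sub>R (2 * fst n) *\<^sub>R n"
    unfolding boost_def p by (simp add: minkowski_simps)
  also have "\<dots> = y + (2 * fst y) *\<^sub>R point_refl n time_axis - (2 * minkowski n y) *\<^sub>R n"
    using assms by simp
  also have "\<dots> = point_refl n (point_refl time_axis y)"
    by (simp add: point_refl_def minkowski_simps algebra_simps)
  finally show ?thesis by simp
qed

text \<open>The witness is the midpoint of \<open>p\<close> and the base point of the hyperboloid.\<close>

lemma hyperboloid_midpoint:
  assumes "p \<in> hyperboloid"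
  obtains n where "n \<in> hyperboloid" "p = point_refl n time_axis"
proof
  \<comment> \<open>\<open>time_axis + p\<close> has Minkowski square
    \<open>2 * (1 + fst p)\<close>; this factor normalizes it to 1.\<close>
  define c where "c = 1 / sqrt (2 * (1 + fst p))"
  have pos: "1 + fst p > 0"
    using hyperboloidD[OF assms] by simp
  have c: "c > 0" "c * c * (2 * (1 + fst p)) = 1"
    using pos by (simp_all add: c_def)
  have "minkowski (c *\<^sub>R (time_axis + p)) (c *\<^sub>R (time_axis + p)) = c * c * (2 * (1 + fst p))"
    using hyperboloidD(1)[OF assms] by (simp add: minkowski_simps) (simp add: algebra_simps)
  then show "c *\<^sub>R (time_axis + p) \<in> hyperboloid"
    using c pos by (simp add: hyperboloid_def)
  have "point_refl (c *\<^sub>R (time_axis + p)) time_axis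
      = (c * c * (2 * (1 + fst p))) *\<^sub>R (time_axis + p) - time_axis"
    by (simp add: point_refl_def minkowski_simps mult_ac)
  then show "p = point_refl (c *\<^sub>R (time_axis + p)) time_axis"
    unfolding c by simp
qed

lemma boost_factorization:
  assumes "p \<in> hyperboloid"
  obtains n where "n \<in> hyperboloid" "p = point_refl n time_axis"
    "boost p = (\<lambda>y. point_refl n (point_refl time_axis y))"
proof -
  obtain n where n: "n \<in> hyperboloid" "p = point_refl n time_axis"
    using hyperboloid_midpoint[OF assms] .
  then have "boost p = (\<lambda>y. point_refl n (point_refl time_axis y))"
    using hyperboloidD(2)[OF n(1)] by (simp add: boost_eq_point_refl fun_eq_iff)
  with n show ?thesis
    by (rule that)
qed

lemma lorentz_map_boost:
  assumes "p \<in> hyperboloid"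
  shows "lorentz_map (boost p)"
proof -
  obtain n where n: "n \<in> hyperboloid" "p = point_refl n time_axis"
    "boost p = (\<lambda>y. point_refl n (point_refl time_axis y))"
    by (rule boost_factorization[OF assms])
  have "lorentz_map (\<lambda>y. point_refl n (point_refl time_axis y))"
    using hyperboloidD(1)[OF n(1)]
    by (intro lorentz_map_comp[OF lorentz_map_point_refl lorentz_map_point_refl]) simp_all
  then show ?thesis
    unfolding n(3) .
qed

lemma boost_time_axis:
  assumes "p \<in> hyperboloid"
  shows "boost p time_axis = p" "boost time_axis y = y"
proof -
  have "boost p time_axis = time_axis + 2 *\<^sub>R p - (time_axis + p)"
    using hyperboloidD(2)[OF assms] by (simp add: boost_def minkowski_simps)
  then show "boost p time_axis = p"
    by (simp add: scaleR_2)
  show "boost time_axis y = y"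
    by (simp add: boost_def minkowski_simps mult.commute flip: scaleR_2)
qed

text \<open>Read on the ball, this is the identity for the Lorentz factor of a sum.\<close>

lemma fst_boost:
  assumes "p \<in> hyperboloid"
  shows "fst (boost p y) = fst p * fst y + snd p \<bullet> snd y"
proof -
  have "fst (boost p y) = fst y + 2 * fst y * fst p - (fst y + minkowski p y)"
    using hyperboloidD(2)[OF assms] by (simp add: boost_def minkowski_simps)
  then show ?thesis
    by (simp add: minkowski_def)
qed

lemma boost_in_hyperboloid:
  assumes "p \<in> hyperboloid" "y \<in> hyperboloid"
  shows "boost p y \<in> hyperboloid"
  using lorentz_map_minkowski[OF lorentz_map_boost[OF assms(1)], of y y] fst_boost[OF assms(1), of y]
    hyperboloidD(1)[OF assms(2)] abs_inner_snd_less[OF assms]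
  by (simp add: hyperboloid_def abs_less_iff)

text \<open>Conjugating \<open>boost p\<close>, the product of the reflections at \<open>n\<close>
  and at the base point, by the latter swaps the two factors and so yields the inverse.\<close>

lemma boost_point_refl_cancel:
  assumes "p \<in> hyperboloid"
  shows "boost (point_refl time_axis p) (boost p y) = y"
proof -
  let ?s = "point_refl time_axis"
  obtain n where n: "n \<in> hyperboloid" "p = point_refl n time_axis"
    "boost p = (\<lambda>y. point_refl n (?s y))"
    by (rule boost_factorization[OF assms])
  have s: "lorentz_map ?s" "?s time_axis = time_axis" "\<And>y. ?s (?s y) = y"
    by (simp_all add: lorentz_map_point_refl point_refl_self point_refl_invol)
  have "boost (?s p) (boost p y) = ?s (boost p (?s (boost p y)))"
    by (simp only: boost_conj[OF s(1,2)] s(3))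
  also have "\<dots> = y"
    using hyperboloidD(1)[OF n(1)] by (simp only: n(3) s(3) point_refl_invol)
  finally show ?thesis .
qed

text \<open>With boosts written as \<open>\<sigma>\<^sub>n \<sigma>\<^sub>e\<close>, where \<open>\<sigma>\<close> denotes point reflections and \<open>e\<close> the base
  point, the product on the left collapses to \<open>\<sigma>\<^sub>m \<sigma>\<^sub>e\<close> because a conjugate of a point reflection
  is a point reflection.\<close>

lemma boost_bol:
  assumes b: "b \<in> hyperboloid" and a: "a \<in> hyperboloid"
  shows "boost b (boost a (boost b y)) = boost (boost b (boost a b)) y"
proof -
  let ?s = "point_refl time_axis"
  obtain B where B: "B \<in> hyperboloid" "b = point_refl B time_axis"
    "boost b = (\<lambda>y. point_refl B (?s y))"
    by (rule boost_factorization[OF b])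
  obtain A where A: "A \<in> hyperboloid" "a = point_refl A time_axis"
    "boost a = (\<lambda>y. point_refl A (?s y))"
    by (rule boost_factorization[OF a])
  let ?N = "boost b A"
  have N: "?N \<in> hyperboloid"
    using boost_in_hyperboloid[OF b A(1)] .
  have *: "boost b (boost a (boost b y)) = point_refl ?N (?s y)" for y
  proof -
    have "boost b (boost a (boost b y)) = point_refl ?N (boost b (?s (boost b y)))"
      by (simp only: A(3) point_refl_conj[OF lorentz_map_boost[OF b]])
    also have "boost b (?s (boost b y)) = ?s y"
      using hyperboloidD(1)[OF B(1)] by (simp add: B(3) point_refl_invol)
    finally show ?thesis .
  qed
  \<comment> \<open>The reflection \<open>?s\<close> fixes the base point, so evaluating there shows
    which boost the product is.\<close>
  have "boost b (boost a b) = point_refl ?N time_axis"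
    using *[of time_axis] boost_time_axis(1)[OF b] by (simp add: point_refl_self)
  then show ?thesis
    using * boost_eq_point_refl[of ?N y] hyperboloidD(2)[OF N] by simp
qed

section \<open>The correspondence between the ball and the hyperboloid\<close>

definition to_hyperboloid :: "'a::real_inner \<Rightarrow> real \<times> 'a" where
  "to_hyperboloid u = (lorentz_factor u, lorentz_factor u *\<^sub>R u)"

text \<open>Central projection onto the hyperplane of first coordinate 1.\<close>

definition from_hyperboloid :: "real \<times> 'a::real_inner \<Rightarrow> 'a" where
  "from_hyperboloid p = (1 / fst p) *\<^sub>R snd p"

lemma lorentz_factor_pos: "norm u < 1 \<Longrightarrow> lorentz_factor u > 0"
  by (simp add: lorentz_factor_def abs_square_less_1)

lemma lorentz_factor_sq: "norm u < 1 \<Longrightarrow> (lorentz_factor u)\<^sup>2 * (1 - (norm u)\<^sup>2) = 1"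
  using abs_square_less_1[of "norm u"] by (simp add: lorentz_factor_def power_divide)

lemma to_hyperboloid_in: "norm u < 1 \<Longrightarrow> to_hyperboloid u \<in> hyperboloid"
  using lorentz_factor_sq[of u] lorentz_factor_pos[of u]
  by (simp add: to_hyperboloid_def hyperboloid_def minkowski_self power_mult_distrib algebra_simps)

lemma from_to_hyperboloid: "norm u < 1 \<Longrightarrow> from_hyperboloid (to_hyperboloid u) = u"
  using lorentz_factor_pos[of u] by (simp add: to_hyperboloid_def from_hyperboloid_def)

text \<open>Membership says \<open>t\<^sup>2 * (1 - (norm w)\<^sup>2) = 1\<close>, which bounds
  \<open>w\<close> and determines the positive number \<open>t\<close>.\<close>

lemma scaled_in_hyperboloid:
  assumes "(t, t *\<^sub>R w) \<in> hyperboloid"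
  shows "norm w < 1" "to_hyperboloid w = (t, t *\<^sub>R w)"
proof -
  have t: "t > 0" and tw: "t\<^sup>2 * (1 - (norm w)\<^sup>2) = 1"
    using assms
    by (simp_all add: hyperboloid_def minkowski_self power_mult_distrib algebra_simps)
  have eq: "1 - (norm w)\<^sup>2 = 1 / t\<^sup>2"
    using t tw by (simp add: field_simps)
  then have "(norm w)\<^sup>2 < 1"
    using t by (smt (verit) zero_less_divide_1_iff zero_less_power)
  then show "norm w < 1"
    by (simp add: power_less_one_iff)
  have "lorentz_factor w = t"
    using t unfolding lorentz_factor_def eq by (simp add: real_sqrt_divide)
  then show "to_hyperboloid w = (t, t *\<^sub>R w)"
    by (simp add: to_hyperboloid_def)
qed

lemma from_hyperboloid:
  assumes "p \<in> hyperboloid"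
  shows "norm (from_hyperboloid p) < 1" "to_hyperboloid (from_hyperboloid p) = p"
proof -
  have p: "p = (fst p, fst p *\<^sub>R from_hyperboloid p)"
    using hyperboloidD(2)[OF assms] by (simp add: from_hyperboloid_def)
  with assms have "(fst p, fst p *\<^sub>R from_hyperboloid p) \<in> hyperboloid"
    by simp
  from scaled_in_hyperboloid[OF this] p
  show "norm (from_hyperboloid p) < 1" "to_hyperboloid (from_hyperboloid p) = p"
    by simp_all
qed

lemma to_hyperboloid_inject:
  "norm u < 1 \<Longrightarrow> norm v < 1 \<Longrightarrow> to_hyperboloid u = to_hyperboloid v \<Longrightarrow> u = v"
  by (metis from_to_hyperboloid)

text \<open>The right side is kept as a multiple \<open>t\<close> of (1, sum), because it is not yet
  known that the sum lies in the ball.\<close>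

lemma boost_to_hyperboloid:
  assumes u: "norm u < 1" and v: "norm v < 1"
  shows "boost (to_hyperboloid u) (to_hyperboloid v) =
    (let t = lorentz_factor u * lorentz_factor v * (1 + u \<bullet> v) in (t, t *\<^sub>R einstein_add u v))"
proof -
  let ?g = "lorentz_factor u" and ?h = "lorentz_factor v"
  note pos = lorentz_factor_pos[OF u] lorentz_factor_pos[OF v]
  have "\<bar>u \<bullet> v\<bar> < 1"
    using abs_inner_snd_less[OF to_hyperboloid_in[OF u] to_hyperboloid_in[OF v]] pos
    by (simp add: to_hyperboloid_def abs_mult)
  then have uv: "1 + u \<bullet> v \<noteq> 0"
    by linarith
  have "(?g * ?h * (1 + u \<bullet> v)) *\<^sub>R einstein_add u v =
     (?g * ?h) *\<^sub>R (u + (1 / ?g) *\<^sub>R v + (?g / (1 + ?g) * (u \<bullet> v)) *\<^sub>R u)"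
    unfolding einstein_add_def using uv by simp
  also have "\<dots> = ?h *\<^sub>R v + (?g * ?h + ?g * ?h * (?g / (1 + ?g) * (u \<bullet> v))) *\<^sub>R u"
    using pos by (simp add: scaleR_add_right scaleR_add_left)
  \<comment> \<open>Brings the coefficient of \<open>u\<close> into the shape that unfolding
    \<open>boost\<close> produces.\<close>
  also have "?g * ?h + ?g * ?h * (?g / (1 + ?g) * (u \<bullet> v)) =
      2 * ?h * ?g - (?h + ?g * ?h - ?g * (?h * (u \<bullet> v))) / (1 + ?g) * ?g"
    using pos by (simp add: field_simps)
  finally have "snd (boost (to_hyperboloid u) (to_hyperboloid v)) =
      (?g * ?h * (1 + u \<bullet> v)) *\<^sub>R einstein_add u v"
    by (simp add: boost_def to_hyperboloid_def minkowski_simps minkowski_def scaleR_diff_left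
        distrib_right)
  moreover have "fst (boost (to_hyperboloid u) (to_hyperboloid v)) = ?g * ?h * (1 + u \<bullet> v)"
    unfolding fst_boost[OF to_hyperboloid_in[OF u]] by (simp add: to_hyperboloid_def algebra_simps)
  ultimately show ?thesis
    by (simp add: Let_def prod_eq_iff)
qed

text \<open>The boosted point lies on the hyperboloid, so \<open>scaled_in_hyperboloid\<close>
  yields closure, the transfer to boosts and the Lorentz factor at once.\<close>

lemma einstein_add_hyperboloid:
  assumes "norm u < 1" "norm v < 1"
  shows "norm (einstein_add u v) < 1"
    and "to_hyperboloid (einstein_add u v) = boost (to_hyperboloid u) (to_hyperboloid v)"
    and "lorentz_factor (einstein_add u v) = lorentz_factor u * lorentz_factor v * (1 + u \<bullet> v)"
proof -
  define t where "t = lorentz_factor u * lorentz_factor v * (1 + u \<bullet> v)"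
  have eq: "boost (to_hyperboloid u) (to_hyperboloid v) = (t, t *\<^sub>R einstein_add u v)"
    using boost_to_hyperboloid[OF assms] by (simp add: t_def Let_def)
  then have "(t, t *\<^sub>R einstein_add u v) \<in> hyperboloid"
    using boost_in_hyperboloid to_hyperboloid_in assms by metis
  note * = scaled_in_hyperboloid[OF this]
  show "norm (einstein_add u v) < 1"
    by (fact *)
  show "to_hyperboloid (einstein_add u v) = boost (to_hyperboloid u) (to_hyperboloid v)"
    by (simp add: * eq)
  show "lorentz_factor (einstein_add u v) = lorentz_factor u * lorentz_factor v * (1 + u \<bullet> v)"
    using *(2) by (simp add: to_hyperboloid_def t_def)
qed

section \<open>Algebraic laws of Einstein addition, transferred from boosts\<close>

lemma to_hyperboloid_zero: "to_hyperboloid 0 = time_axis"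
  by (simp add: to_hyperboloid_def lorentz_factor_def time_axis_def)

lemma to_hyperboloid_minus: "to_hyperboloid (- u) = point_refl time_axis (to_hyperboloid u)"
  by (simp add: to_hyperboloid_def lorentz_factor_def point_refl_time_axis)

lemma einstein_add_zero_left: "einstein_add 0 v = v"
  by (simp add: einstein_add_def lorentz_factor_def)

lemma einstein_add_minus_left:
  assumes "norm u < 1"
  shows "einstein_add (- u) u = 0"
proof (rule to_hyperboloid_inject)
  have "to_hyperboloid (einstein_add (- u) u)
      = boost (point_refl time_axis (to_hyperboloid u)) (boost (to_hyperboloid u) time_axis)"
    using assms by (simp add: einstein_add_hyperboloid to_hyperboloid_minus
        boost_time_axis to_hyperboloid_in)
  also have "\<dots> = to_hyperboloid 0"
    using assms by (simp only: boost_point_refl_cancel to_hyperboloid_in to_hyperboloid_zero)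
  finally show "to_hyperboloid (einstein_add (- u) u) = to_hyperboloid 0" .
qed (use assms in \<open>simp_all add: einstein_add_hyperboloid\<close>)

lemma einstein_add_left_cancel:
  assumes "norm u < 1" "norm v < 1"
  shows "einstein_add (- u) (einstein_add u v) = v"
  by (rule to_hyperboloid_inject)
    (use assms in \<open>simp_all add: einstein_add_hyperboloid to_hyperboloid_minus to_hyperboloid_in
      boost_point_refl_cancel\<close>)

lemma einstein_add_bol:
  assumes "norm u < 1" "norm v < 1" "norm w < 1"
  shows "einstein_add u (einstein_add v (einstein_add u w))
    = einstein_add (einstein_add u (einstein_add v u)) w"
  by (rule to_hyperboloid_inject)
    (use assms in \<open>simp_all add: einstein_add_hyperboloid to_hyperboloid_in boost_bol\<close>)

section \<open>Gyrations, obtained by solving the gyroassociative law with left cancellation\<close>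

definition einstein_gyr :: "'a::real_inner \<Rightarrow> 'a \<Rightarrow> 'a \<Rightarrow> 'a" where
  "einstein_gyr a b c =
     einstein_add (- einstein_add a b) (einstein_add a (einstein_add b c))"

lemma einstein_gyr_closed:
  "norm a < 1 \<Longrightarrow> norm b < 1 \<Longrightarrow> norm c < 1 \<Longrightarrow> norm (einstein_gyr a b c) < 1"
  by (simp add: einstein_gyr_def einstein_add_hyperboloid)

lemma einstein_add_gyr:
  assumes "norm a < 1" "norm b < 1" "norm c < 1"
  shows "einstein_add (einstein_add a b) (einstein_gyr a b c) = einstein_add a (einstein_add b c)"
  using einstein_add_left_cancel[of "- einstein_add a b" "einstein_add a (einstein_add b c)"] assms
  by (simp add: einstein_gyr_def einstein_add_hyperboloid)

text \<open>The map is a product of three boosts. That it fixes the base point is the fact that the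
  gyration fixes 0.\<close>

lemma einstein_gyr_lorentz_map:
  assumes a: "norm a < 1" and b: "norm b < 1"
  obtains f where "lorentz_map f" "f time_axis = time_axis"
    "\<And>c. norm c < 1 \<Longrightarrow> to_hyperboloid (einstein_gyr a b c) = f (to_hyperboloid c)"
proof
  let ?f = "\<lambda>y. boost (to_hyperboloid (- einstein_add a b))
      (boost (to_hyperboloid a) (boost (to_hyperboloid b) y))"
  have ab: "norm (einstein_add a b) < 1"
    using a b by (rule einstein_add_hyperboloid)
  show "lorentz_map ?f"
    using a b ab
    by (intro lorentz_map_comp[OF lorentz_map_boost lorentz_map_comp[OF lorentz_map_boost lorentz_map_boost]]
        to_hyperboloid_in) simp_all
  show f: "to_hyperboloid (einstein_gyr a b c) = ?f (to_hyperboloid c)" if "norm c < 1" for c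
    using a b ab that by (simp add: einstein_gyr_def einstein_add_hyperboloid)
  have "einstein_gyr a b 0 = 0"
  proof -
    \<comment> \<open>The right identity law: cancel \<open>- b\<close> from \<open>- b\<close> plus
      \<open>b\<close>, which is 0.\<close>
    have "einstein_add b 0 = b"
      using einstein_add_left_cancel[of "- b" b] einstein_add_minus_left[of b] b by simp
    then show ?thesis
      using einstein_add_minus_left[OF ab] by (simp add: einstein_gyr_def)
  qed
  then show "?f time_axis = time_axis"
    using f[of 0] by (simp add: to_hyperboloid_zero)
qed

text \<open>The Lorentz factor is the form paired with the base point, hence invariant, and it
  determines the norm.\<close>

lemma norm_einstein_gyr:
  assumes "norm a < 1" "norm b < 1" "norm c < 1"
  shows "norm (einstein_gyr a b c) = norm c"
proof -
  obtain f where f: "lorentz_map f" "f time_axis = time_axis"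
    "to_hyperboloid (einstein_gyr a b c) = f (to_hyperboloid c)"
    using einstein_gyr_lorentz_map assms by metis
  have "lorentz_factor (einstein_gyr a b c) = minkowski (f time_axis) (f (to_hyperboloid c))"
    unfolding f(3)[symmetric] f(2) by (simp add: to_hyperboloid_def)
  also have "\<dots> = lorentz_factor c"
    using lorentz_map_minkowski[OF f(1)] by (simp add: to_hyperboloid_def)
  finally have "(norm (einstein_gyr a b c))\<^sup>2 = (norm c)\<^sup>2"
    by (simp add: lorentz_factor_def)
  then show ?thesis by simp
qed

text \<open>On the hyperboloid this is \<open>boost_conj\<close> for the Lorentz map inducing the
  gyration.\<close>

lemma einstein_gyr_add:
  assumes a: "norm a < 1" and b: "norm b < 1" and c: "norm c < 1" and d: "norm d < 1"
  shows "einstein_gyr a b (einstein_add c d) = einstein_add (einstein_gyr a b c) (einstein_gyr a b d)"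
proof (rule to_hyperboloid_inject)
  obtain f where f: "lorentz_map f" "f time_axis = time_axis"
    "\<And>c. norm c < 1 \<Longrightarrow> to_hyperboloid (einstein_gyr a b c) = f (to_hyperboloid c)"
    using einstein_gyr_lorentz_map[OF a b] by metis
  show "to_hyperboloid (einstein_gyr a b (einstein_add c d))
      = to_hyperboloid (einstein_add (einstein_gyr a b c) (einstein_gyr a b d))"
    using assms by (simp add: f einstein_add_hyperboloid einstein_gyr_closed boost_conj[OF f(1,2)])
qed (use assms in \<open>simp_all add: einstein_gyr_closed einstein_add_hyperboloid\<close>)

text \<open>A gyration is a product of three left translations; the witness undoes them in reverse
  order.\<close>

lemma einstein_gyr_bij:
  assumes a: "norm a < 1" and b: "norm b < 1"
  shows "bij_betw (einstein_gyr a b) {v. norm v < 1} {v. norm v < 1}"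
proof (rule bij_betw_byWitness[where f' = "\<lambda>c. einstein_add (- b)
    (einstein_add (- a) (einstein_add (einstein_add a b) c))"])
  have *: "einstein_add u (einstein_add (- u) v) = v" if "norm u < 1" "norm v < 1"
    for u v :: 'a
    using einstein_add_left_cancel[of "- u" v] that by simp
  show "\<forall>c\<in>{v. norm v < 1}. einstein_add (- b) (einstein_add (- a)
      (einstein_add (einstein_add a b) (einstein_gyr a b c))) = c"
    using a b by (simp add: einstein_add_gyr einstein_add_left_cancel einstein_add_hyperboloid)
  show "\<forall>c\<in>{v. norm v < 1}. einstein_gyr a b (einstein_add (- b) (einstein_add (- a)
      (einstein_add (einstein_add a b) c))) = c"
    using a b by (simp add: einstein_gyr_def * einstein_add_left_cancel einstein_add_hyperboloid)
qed (use a b in \<open>auto simp: einstein_gyr_closed einstein_add_hyperboloid\<close>)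

text \<open>For \<open>w = a \<oplus> b\<close> the Bol identity with middle factor \<open>\<ominus>a\<close> applies, since
  \<open>\<ominus>a \<oplus> w = b\<close> and \<open>w \<oplus> gyr[a,b]c = a \<oplus> (b \<oplus> c)\<close>.\<close>

lemma einstein_gyr_loop:
  assumes a: "norm a < 1" and b: "norm b < 1" and c: "norm c < 1"
  shows "einstein_gyr (einstein_add a b) b c = einstein_gyr a b c"
proof -
  let ?w = "einstein_add a b" and ?d = "einstein_gyr a b c"
  have w: "norm ?w < 1" and d: "norm ?d < 1"
    using assms by (simp_all add: einstein_add_hyperboloid einstein_gyr_closed)
  have "einstein_add ?w (einstein_add b c)
      = einstein_add ?w (einstein_add (- a) (einstein_add ?w ?d))"
    using assms by (simp add: einstein_add_gyr einstein_add_left_cancel einstein_add_hyperboloid)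
  also have "\<dots> = einstein_add (einstein_add ?w b) ?d"
    using assms w d by (simp add: einstein_add_bol einstein_add_left_cancel)
  finally show ?thesis
    using w b d by (simp add: einstein_gyr_def[of ?w] einstein_add_left_cancel einstein_add_hyperboloid)
qed

section \<open>The gyrogroup axioms for the ball\<close>

lemma einstein_gyrogroup_simps [simp]:
  "carrier einstein_gyrogroup = {v. norm v < 1}"
  "a \<otimes>\<^bsub>einstein_gyrogroup\<^esub> b = einstein_add a b"
  "\<one>\<^bsub>einstein_gyrogroup\<^esub> = 0"
  by (simp_all add: einstein_gyrogroup_def)

text \<open>The restriction makes the map extensional, as \<open>auto\<close> demands.\<close>

lemma einstein_gyr_auto:
  assumes "norm a < 1" "norm b < 1"
  shows "restrict (einstein_gyr a b) {v. norm v < 1} \<in> auto einstein_gyrogroup"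
proof -
  have "bij_betw (restrict (einstein_gyr a b) {v. norm v < 1}) {v. norm v < 1} {v. norm v < 1}"
    using einstein_gyr_bij[OF assms] by (rule bij_betw_cong[THEN iffD1, rotated]) simp
  moreover have "restrict (einstein_gyr a b) {v. norm v < 1} \<in> hom einstein_gyrogroup einstein_gyrogroup"
    using assms
    by (auto simp: hom_def einstein_gyr_closed einstein_gyr_add einstein_add_hyperboloid)
  ultimately show ?thesis
    by (simp add: auto_def Bij_def)
qed

text \<open>Left cancellation gives uniqueness. The general \<open>gyr_ex1\<close> lives inside
  \<open>gyrogroup\<close>, whose loop axiom is verified by means of this value.\<close>

lemma gyr_einstein_gyrogroup:
  assumes a: "norm a < 1" and b: "norm b < 1"
  shows "gyr einstein_gyrogroup a b = restrict (einstein_gyr a b) {v. norm v < 1}"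
  unfolding gyr_def
proof (rule the_equality)
  show "restrict (einstein_gyr a b) {v. norm v < 1} \<in> auto einstein_gyrogroup \<and>
    (\<forall>c\<in>carrier einstein_gyrogroup. a \<otimes>\<^bsub>einstein_gyrogroup\<^esub> (b \<otimes>\<^bsub>einstein_gyrogroup\<^esub> c) =
      (a \<otimes>\<^bsub>einstein_gyrogroup\<^esub> b) \<otimes>\<^bsub>einstein_gyrogroup\<^esub> restrict (einstein_gyr a b) {v. norm v < 1} c)"
    using assms einstein_gyr_auto by (simp add: einstein_add_gyr)
next
  fix \<phi>
  assume *: "\<phi> \<in> auto einstein_gyrogroup \<and>
    (\<forall>c\<in>carrier einstein_gyrogroup. a \<otimes>\<^bsub>einstein_gyrogroup\<^esub> (b \<otimes>\<^bsub>einstein_gyrogroup\<^esub> c) =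
      (a \<otimes>\<^bsub>einstein_gyrogroup\<^esub> b) \<otimes>\<^bsub>einstein_gyrogroup\<^esub> \<phi> c)"
  then have \<phi>: "bij_betw \<phi> {v. norm v < 1} {v. norm v < 1}" "\<phi> \<in> extensional {v. norm v < 1}"
    by (simp_all add: auto_def Bij_def)
  show "\<phi> = restrict (einstein_gyr a b) {v. norm v < 1}"
  proof (rule extensionalityI[OF \<phi>(2)])
    fix c :: 'a assume c: "c \<in> {v. norm v < 1}"
    then have "norm (\<phi> c) < 1"
      using bij_betw_apply[OF \<phi>(1)] by blast
    moreover have "einstein_add a (einstein_add b c) = einstein_add (einstein_add a b) (\<phi> c)"
      using * c by simp
    ultimately have "einstein_gyr a b c = \<phi> c"
      using a b by (simp add: einstein_gyr_def einstein_add_left_cancel einstein_add_hyperboloid)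
    then show "\<phi> c = restrict (einstein_gyr a b) {v. norm v < 1} c"
      using c by simp
  qed simp
qed

lemma gyrogroup_einstein: "gyrogroup (einstein_gyrogroup :: 'a::real_inner monoid)"
proof
  fix a b :: 'a
  assume a: "a \<in> carrier einstein_gyrogroup" and b: "b \<in> carrier einstein_gyrogroup"
  have ab: "norm a < 1" "norm b < 1"
    using a b by simp_all
  show "\<exists>\<phi>\<in>auto einstein_gyrogroup. \<forall>c\<in>carrier einstein_gyrogroup.
      a \<otimes>\<^bsub>einstein_gyrogroup\<^esub> (b \<otimes>\<^bsub>einstein_gyrogroup\<^esub> c) =
      (a \<otimes>\<^bsub>einstein_gyrogroup\<^esub> b) \<otimes>\<^bsub>einstein_gyrogroup\<^esub> \<phi> c"
    using ab by (intro bexI[OF _ einstein_gyr_auto[OF ab]]) (simp add: einstein_add_gyr)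
  show "gyr einstein_gyrogroup (a \<otimes>\<^bsub>einstein_gyrogroup\<^esub> b) b = gyr einstein_gyrogroup a b"
    using ab by (auto simp: gyr_einstein_gyrogroup einstein_add_hyperboloid einstein_gyr_loop
        intro!: restrict_ext)
next
  fix a :: 'a
  assume "a \<in> carrier einstein_gyrogroup"
  then show "\<exists>b\<in>carrier einstein_gyrogroup. b \<otimes>\<^bsub>einstein_gyrogroup\<^esub> a = \<one>\<^bsub>einstein_gyrogroup\<^esub>"
    by (intro bexI[of _ "- a"]) (simp_all add: einstein_add_minus_left)
qed (simp_all add: einstein_add_hyperboloid einstein_add_zero_left)

section \<open>Rapidity and the triangle inequality\<close>

lemma tanh_artanh_real:
  fixes x :: real
  assumes "\<bar>x\<bar> < 1"
  shows "tanh (artanh x) = x"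
proof -
  \<comment> \<open>\<open>artanh\<close> is half a logarithm, and \<open>tanh\<close> is a rational
    function of this exponential.\<close>
  have "exp (- 2 * artanh x) = (1 - x) / (1 + x)"
    using assms by (simp add: artanh_def exp_minus abs_less_iff)
  then show ?thesis
    using assms unfolding tanh_real_altdef by (simp only:) (simp add: field_simps)
qed

lemma artanh_nonneg: "0 \<le> x \<Longrightarrow> x < 1 \<Longrightarrow> 0 \<le> artanh (x::real)"
  by (simp add: artanh_def)

text \<open>Since \<open>norm u\<close> is the \<open>tanh\<close> of
  \<open>artanh (norm u)\<close>, this is the identity that 1 minus the square of
  \<open>tanh\<close> is the inverse square of \<open>cosh\<close>.\<close>

lemma lorentz_factor_eq_cosh:
  assumes "norm u < 1"
  shows "lorentz_factor u = cosh (artanh (norm u))"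
proof -
  let ?x = "artanh (norm u)"
  have "norm u = sinh ?x / cosh ?x"
    using tanh_artanh_real[of "norm u"] assms by (simp add: tanh_def)
  then have "1 - (norm u)\<^sup>2 = 1 - (sinh ?x / cosh ?x)\<^sup>2"
    by simp
  also have "\<dots> = 1 / (cosh ?x)\<^sup>2"
    by (simp add: power_divide sinh_square_eq diff_divide_distrib)
  finally have "1 - (norm u)\<^sup>2 = 1 / (cosh ?x)\<^sup>2" .
  then show ?thesis
    by (simp add: lorentz_factor_def real_sqrt_divide)
qed

text \<open>Both sides are nonnegative and \<open>cosh\<close> is increasing there, so it suffices
  to compare their \<open>cosh\<close>.\<close>

lemma artanh_norm_einstein_add_le:
  assumes u: "norm u < 1" and v: "norm v < 1"
  shows "artanh (norm (einstein_add u v)) \<le> artanh (norm u) + artanh (norm v)"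
proof -
  let ?x = "artanh (norm u)" and ?y = "artanh (norm v)"
  have "cosh (artanh (norm (einstein_add u v))) = cosh ?x * cosh ?y * (1 + u \<bullet> v)"
    using assms by (simp add: einstein_add_hyperboloid flip: lorentz_factor_eq_cosh)
  \<comment> \<open>Cauchy-Schwarz, with the two norms written as \<open>tanh ?x\<close> and
    \<open>tanh ?y\<close>.\<close>
  also have "\<dots> \<le> cosh ?x * cosh ?y * (1 + tanh ?x * tanh ?y)"
    using assms norm_cauchy_schwarz[of u v] by (simp add: tanh_artanh_real)
  also have "\<dots> = cosh (?x + ?y)"
    by (simp add: cosh_add tanh_def field_simps)
  finally show ?thesis
    using assms by (simp add: cosh_real_nonneg_le_iff artanh_nonneg einstein_add_hyperboloid)
qed

theorem theorem3p3:
  shows "gyronorm (einstein_gyrogroup :: (real ^ 'n) monoid) (\<lambda>v. artanh (norm v))"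
proof -
  interpret gyrogroup "einstein_gyrogroup :: (real ^ 'n) monoid"
    by (rule gyrogroup_einstein)
  show ?thesis
  proof
    fix x :: "real ^ 'n"
    assume "x \<in> carrier einstein_gyrogroup"
    then have x: "norm x < 1"
      by simp
    show "artanh (norm x) \<ge> 0"
      using x by (simp add: artanh_nonneg)
    show "artanh (norm x) = 0 \<longleftrightarrow> x = \<one>\<^bsub>einstein_gyrogroup\<^esub>"
      \<comment> \<open>Applying \<open>tanh\<close> to \<open>artanh (norm x) = 0\<close> gives
        \<open>norm x = 0\<close>.\<close>
      using x tanh_artanh_real[of "norm x"] by auto
    show "artanh (norm (inv\<^bsub>einstein_gyrogroup\<^esub> x)) = artanh (norm x)"
      using x inv_equality[of x "- x"] by (simp add: einstein_add_minus_left)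
  qed (simp_all add: artanh_norm_einstein_add_le gyr_einstein_gyrogroup norm_einstein_gyr)
qed

end
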